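(* Every spike has property (P+): for any pair $A,B$ of bases of the spike, there exists a path with vertex set $A\triangle B$ that alternates between $A\setminus B$ and $B\setminus A$ and covers $\mathcal{C}[A\cup B]$.
   Context: A rank-$r$ spike with tip $t$ and legs $\{t,x_1,y_1\},\dots,\{t,x_r,y_r\}$ is a rank-$r$ matroid on ground set $\{t,x_1,y_1,\dots,x_r,y_r\}$ such that each leg is a circuit and, for $1\le k\le r-1$, the union of any $k$ legs has rank $k+1$. For a matroid with circuit set $\mathcal{C}$ and a subset $X$ of the ground set, $\mathcal{C}[X]$ is the set of circuits contained in $X$. A path whose vertex set is a set of matroid elements covers a family of circuits if every circuit in the family contains both endpoints of some edge of the path. *)

theory Defs
  imports Main
begin

locale matroid =
  fixes E :: "'a set" and indep :: "'a set \<Rightarrow> bool"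
  assumes finite_ground: "finite E"
    and indep_ground: "indep I \<Longrightarrow> I \<subseteq> E"
    and indep_empty: "indep {}"
    and indep_subset: "indep J \<Longrightarrow> I \<subseteq> J \<Longrightarrow> indep I"
    and indep_augment:
      "indep I \<Longrightarrow> indep J \<Longrightarrow> card I < card J \<Longrightarrow> \<exists>e\<in>J - I. indep (insert e I)"
begin

definition basis :: "'a set \<Rightarrow> bool" where
  "basis B \<longleftrightarrow> indep B \<and> (\<forall>I. indep I \<and> B \<subseteq> I \<longrightarrow> I = B)"

definition circuit :: "'a set \<Rightarrow> bool" where
  "circuit C \<longleftrightarrow> C \<subseteq> E \<and> \<not> indep C \<and> (\<forall>D. D \<subset> C \<longrightarrow> indep D)"

definition rank_of :: "'a set \<Rightarrow> nat" where
  "rank_of X = Max (card ` {I. I \<subseteq> X \<and> indep I})"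

definition circuits_in :: "'a set \<Rightarrow> 'a set set" where
  "circuits_in X = {C. circuit C \<and> C \<subseteq> X}"

end

text \<open>
  A path is given by the list of its vertices in order. The empty list is the path with empty
  vertex set; it is needed for a pair of equal bases.
\<close>

definition path_on :: "'a list \<Rightarrow> 'a set \<Rightarrow> bool" where
  "path_on p V \<longleftrightarrow> distinct p \<and> set p = V"

definition path_edges :: "'a list \<Rightarrow> 'a set set" where
  "path_edges p = {{p ! i, p ! Suc i} | i. Suc i < length p}"

definition alternates :: "'a list \<Rightarrow> 'a set \<Rightarrow> 'a set \<Rightarrow> bool" where
  "alternates p U W \<longleftrightarrow>
    (\<forall>i. Suc i < length p \<longrightarrow>
      p ! i \<in> U \<and> p ! Suc i \<in> W \<or> p ! i \<in> W \<and> p ! Suc i \<in> U)"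

definition covers :: "'a list \<Rightarrow> 'a set set \<Rightarrow> bool" where
  "covers p \<F> \<longleftrightarrow> (\<forall>C\<in>\<F>. \<exists>e\<in>path_edges p. e \<subseteq> C)"

definition (in matroid) property_P_plus :: bool where
  "property_P_plus \<longleftrightarrow>
    (\<forall>A B. basis A \<and> basis B \<longrightarrow>
      (\<exists>p. path_on p ((A - B) \<union> (B - A)) \<and>
           alternates p (A - B) (B - A) \<and>
           covers p (circuits_in (A \<union> B))))"

locale spike = matroid E indep
  for E :: "'a set" and indep :: "'a set \<Rightarrow> bool" +
  fixes r :: nat and t :: 'a and x y :: "nat \<Rightarrow> 'a"
  assumes inj_x: "inj_on x {1..r}"
    and inj_y: "inj_on y {1..r}"
    and disjoint_xy: "x ` {1..r} \<inter> y ` {1..r} = {}"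
    and tip_notin: "t \<notin> x ` {1..r} \<union> y ` {1..r}"
    and ground: "E = {t} \<union> x ` {1..r} \<union> y ` {1..r}"
    and rank: "rank_of E = r"
    and leg_circuit: "i \<in> {1..r} \<Longrightarrow> circuit {t, x i, y i}"
    and legs_rank:
      "1 \<le> k \<Longrightarrow> k \<le> r - 1 \<Longrightarrow> K \<subseteq> {1..r} \<Longrightarrow> card K = k \<Longrightarrow>
        rank_of (\<Union>i\<in>K. {t, x i, y i}) = k + 1"

end

theory Submission
  imports Defs
begin

text \<open>
  Write \<open>H 0 = {t}\<close> and \<open>H i = {x i, y i}\<close>. A dependent set contains \<open>H l \<union> H m\<close> for some
  \<open>l \<noteq> m\<close> or meets every leg outside the tip. A basis is either a transversal of the pairs, or it
  contains one \<open>H l\<close>, misses one pair \<open>H k\<close> and meets every other pair exactly once. On the legs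
  where \<open>A\<close> and \<open>B\<close> have distinct single elements \<open>a i\<close> and \<open>b i\<close>, the path runs through
  \<open>a 1, b 1, a 2, b 2, \<dots>\<close>; the remaining at most four elements of the symmetric difference are put
  in front (or, for two transversals, around it). The edges \<open>{a i, b i}\<close> and those of the prefix
  cover the circuits containing some \<open>H l \<union> H m\<close>. A circuit \<open>C\<close> that meets every leg but contains
  no edge is determined step by step along the path: once it contains the element before \<open>a 1\<close>, it
  contains all \<open>b i\<close> and no \<open>a i\<close>. This puts \<open>C\<close> inside \<open>A\<close>, inside \<open>B\<close> or, if \<open>A\<close> and \<open>B\<close>
  miss each other's full pair, inside a transversal that can be chosen independent, because two
  transversals differing in one leg are not both dependent.
\<close>

section \<open>Paths\<close>

abbreviation avoids :: "'a set \<Rightarrow> 'a list \<Rightarrow> bool" where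
  "avoids C \<equiv> successively (\<lambda>u v. \<not> (u \<in> C \<and> v \<in> C))"

text \<open>Covering only concerns consecutive vertices. In the negated form with
  \<open>successively\<close> it splits along appends, so a circuit that escapes the path can be
  followed along it.\<close>

lemma covers_iff_not_avoids: "covers p \<F> \<longleftrightarrow> (\<forall>C\<in>\<F>. \<not> avoids C p)"
proof -
  have "(\<exists>e\<in>path_edges p. e \<subseteq> C) \<longleftrightarrow> (\<exists>i. Suc i < length p \<and> {p ! i, p ! Suc i} \<subseteq> C)" for C
    unfolding path_edges_def by blast
  then show ?thesis unfolding covers_def successively_conv_nth by simp
qed

lemma alternates_iff_successively:
  "alternates p U V \<longleftrightarrow> successively (\<lambda>u v. u \<in> U \<and> v \<in> V \<or> u \<in> V \<and> v \<in> U) p"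
  unfolding alternates_def successively_conv_nth ..

lemma alternates_commute: "alternates p U V \<longleftrightarrow> alternates p V U"
  unfolding alternates_def by blast

lemma avoids_rev: "avoids C (rev p) \<longleftrightarrow> avoids C p"
  unfolding successively_rev by (auto elim: successively_mono)

lemma avoids_subset: "avoids C p \<Longrightarrow> D \<subseteq> C \<Longrightarrow> avoids D p"
  by (erule successively_mono) blast

section \<open>Zigzags through a sequence of pairs\<close>

definition zigzag :: "('i \<Rightarrow> 'a) \<Rightarrow> ('i \<Rightarrow> 'a) \<Rightarrow> 'i list \<Rightarrow> 'a list" where
  "zigzag a b ds = concat (map (\<lambda>i. [a i, b i]) ds)"

lemma zigzag_simps [simp]:
  "zigzag a b [] = []" "zigzag a b (i # ds) = a i # b i # zigzag a b ds"
  by (simp_all add: zigzag_def)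

lemma zigzag_append: "zigzag a b (ds @ es) = zigzag a b ds @ zigzag a b es"
  by (simp add: zigzag_def)

lemma rev_zigzag: "rev (zigzag a b ds) = zigzag b a (rev ds)"
  by (induction ds) (simp_all add: zigzag_append)

lemma set_zigzag: "set (zigzag a b ds) = a ` set ds \<union> b ` set ds"
  by (induction ds) auto

lemma distinct_zigzag:
  assumes "distinct ds" "\<And>i. i \<in> set ds \<Longrightarrow> a i \<noteq> b i"
    and "\<And>i j. i \<in> set ds \<Longrightarrow> j \<in> set ds \<Longrightarrow> i \<noteq> j \<Longrightarrow> {a i, b i} \<inter> {a j, b j} = {}"
  shows "distinct (zigzag a b ds)"
  using assms
proof (induction ds)
  case (Cons i ds)
  have "{a i, b i} \<inter> {a j, b j} = {}" if "j \<in> set ds" for j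
    using Cons.prems(1) Cons.prems(3)[of i j] that by auto
  then have "a i \<notin> set (zigzag a b ds)" "b i \<notin> set (zigzag a b ds)"
    unfolding set_zigzag by blast+
  moreover have "distinct (zigzag a b ds)" using Cons by simp
  ultimately show ?case using Cons.prems(2)[of i] by simp
qed simp

text \<open>The claim about the head is carried through the induction: the pair in front ends in
  \<open>V\<close>, so the rest has to begin in \<open>U\<close>. The same claim later allows a
  prefix that ends in \<open>V\<close> to be attached.\<close>

lemma alternates_zigzag_append:
  assumes "\<And>i. i \<in> set ds \<Longrightarrow> a i \<in> U \<and> b i \<in> V"
    and "alternates R U V" "R = [] \<or> hd R \<in> U"
  shows "alternates (zigzag a b ds @ R) U V \<and>
    (zigzag a b ds @ R = [] \<or> hd (zigzag a b ds @ R) \<in> U)"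
  using assms unfolding alternates_iff_successively
  by (induction ds) (auto simp: successively_Cons)

lemma avoids_zigzag_pair:
  "avoids C (zigzag a b ds @ R) \<Longrightarrow> i \<in> set ds \<Longrightarrow> \<not> (a i \<in> C \<and> b i \<in> C)"
  by (induction ds) (auto simp: successively_Cons)

text \<open>A domino argument: an element of \<open>C\<close> keeps the next \<open>a i\<close> out
  of \<open>C\<close>, so \<open>C\<close> has to use \<open>b i\<close>, which plays the role of
  \<open>u\<close> for the next pair. The last of these elements keeps out the head of
  \<open>R\<close>.\<close>

lemma avoids_zigzag_forward:
  assumes "avoids C (u # zigzag a b ds @ R)" "u \<in> C"
    and "\<And>i. i \<in> set ds \<Longrightarrow> a i \<in> C \<or> b i \<in> C"
  shows "(\<forall>i\<in>set ds. a i \<notin> C) \<and> (R = [] \<or> hd R \<notin> C)"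
  using assms
proof (induction ds arbitrary: u)
  case Nil
  then show ?case by (auto simp: successively_Cons)
next
  case (Cons i ds)
  have "a i \<notin> C" using Cons.prems(1,2) by simp
  then have "b i \<in> C" using Cons.prems(3)[of i] by auto
  moreover have "avoids C (b i # zigzag a b ds @ R)" using Cons.prems(1) by simp
  ultimately show ?case using Cons.IH[of "b i"] Cons.prems(3) \<open>a i \<notin> C\<close> by simp
qed

text \<open>Reversing the path exchanges \<open>a\<close> and \<open>b\<close> and gives the forward
  domino argument, started at \<open>v\<close>.\<close>

lemma avoids_zigzag_backward:
  assumes "avoids C (Q @ zigzag a b ds @ [v])" "v \<in> C"
    and "\<And>i. i \<in> set ds \<Longrightarrow> a i \<in> C \<or> b i \<in> C"
  shows "(\<forall>i\<in>set ds. b i \<notin> C) \<and> (Q = [] \<or> last Q \<notin> C)"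
proof -
  have "avoids C (rev (Q @ zigzag a b ds @ [v]))" using assms(1) unfolding avoids_rev .
  then have "avoids C (v # zigzag b a (rev ds) @ rev Q)" by (simp add: rev_zigzag)
  then have "(\<forall>i\<in>set (rev ds). b i \<notin> C) \<and> (rev Q = [] \<or> hd (rev Q) \<notin> C)"
    using assms(2,3) by (intro avoids_zigzag_forward) auto
  then show ?thesis by (simp add: hd_rev)
qed

section \<open>Rank and bases of matroids\<close>

context matroid
begin

lemma finite_indep: "indep I \<Longrightarrow> finite I"
  using finite_ground indep_ground finite_subset by blast

lemma finite_indep_sets: "finite {I. I \<subseteq> X \<and> indep I}"
  by (rule finite_subset[of _ "Pow E"]) (use finite_ground indep_ground in auto)

lemma card_le_rank_of: "indep I \<Longrightarrow> I \<subseteq> X \<Longrightarrow> card I \<le> rank_of X"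
  unfolding rank_of_def using finite_indep_sets by (intro Max_ge) auto

lemma rank_of_attained: "\<exists>J\<subseteq>X. indep J \<and> card J = rank_of X"
proof -
  have "rank_of X \<in> card ` {I. I \<subseteq> X \<and> indep I}"
    unfolding rank_of_def using finite_indep_sets indep_empty by (intro Max_in) auto
  then show ?thesis by auto
qed

lemma indep_extend:
  assumes "indep I" "I \<subseteq> X"
  shows "\<exists>J. I \<subseteq> J \<and> J \<subseteq> X \<and> indep J \<and> card J = rank_of X"
  using assms
proof (induction "rank_of X - card I" arbitrary: I)
  case 0
  then show ?case using card_le_rank_of[of I X] by (intro exI[of _ I]) auto
next
  case (Suc n)
  obtain J where J: "J \<subseteq> X" "indep J" "card J = rank_of X" using rank_of_attained by blast
  then have "card I < card J" using Suc.hyps(2) by simp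
  then obtain e where e: "e \<in> J - I" "indep (insert e I)"
    using indep_augment Suc.prems(1) J(2) by blast
  have "card (insert e I) = Suc (card I)"
    using e finite_indep[OF Suc.prems(1)] by simp
  then have "n = rank_of X - card (insert e I)" using Suc.hyps(2) by simp
  then obtain J' where "insert e I \<subseteq> J'" "J' \<subseteq> X" "indep J'" "card J' = rank_of X"
    using Suc.hyps(1)[of "insert e I"] e J(1) Suc.prems(2) by blast
  then show ?case by blast
qed

text \<open>If the rank of \<open>U\<close> were larger, some \<open>e\<close> outside
  \<open>S\<close> would augment a maximum independent subset of \<open>S\<close>. Extending
  \<open>C - {e}\<close> to a maximum independent subset of \<open>S\<close> and augmenting again
  can only add \<open>e\<close>, which would make the circuit \<open>C\<close> independent.\<close>

lemma rank_of_eq_if_spanned: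
  assumes "S \<subseteq> U"
    and spanned: "\<And>e. e \<in> U - S \<Longrightarrow> \<exists>C. circuit C \<and> e \<in> C \<and> C \<subseteq> insert e S"
  shows "rank_of S = rank_of U"
proof (rule ccontr)
  assume neq: "rank_of S \<noteq> rank_of U"
  obtain J where J: "J \<subseteq> S" "indep J" "card J = rank_of S" using rank_of_attained by blast
  obtain J' where J': "J' \<subseteq> U" "indep J'" "card J' = rank_of U" using rank_of_attained by blast
  have "rank_of S \<le> rank_of U" using card_le_rank_of[of J U] J assms(1) by auto
  then have "card J < card J'" using neq J(3) J'(3) by simp
  then obtain e where e: "e \<in> J' - J" "indep (insert e J)"
    using indep_augment J(2) J'(2) by blast
  have card_eJ: "card (insert e J) = Suc (rank_of S)"
    using e J finite_indep[OF J(2)] by simp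
  have "e \<notin> S"
    using card_le_rank_of[of "insert e J" S] e J card_eJ by auto
  then obtain C where C: "circuit C" "e \<in> C" "C \<subseteq> insert e S"
    using spanned e(1) J'(1) by blast
  have "indep (C - {e})" using C(1,2) unfolding circuit_def by blast
  then obtain J2 where J2: "C - {e} \<subseteq> J2" "J2 \<subseteq> S" "indep J2" "card J2 = rank_of S"
    using indep_extend[of "C - {e}" S] C(3) by blast
  then obtain g where g: "g \<in> insert e J - J2" "indep (insert g J2)"
    using indep_augment[OF J2(3) e(2)] card_eJ by auto
  have "card (insert g J2) = Suc (rank_of S)"
    using g J2 finite_indep[OF J2(3)] by simp
  then have "\<not> insert g J2 \<subseteq> S"
    using card_le_rank_of[OF g(2), of S] by auto
  then have "g = e" using g(1) J(1) J2(2) by auto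
  then have "indep C" using indep_subset[OF g(2), of C] J2(1) by blast
  then show False using C(1) unfolding circuit_def by blast
qed

lemma indep_if_card_le_rank_of:
  assumes "finite S" "card S \<le> rank_of S"
  shows "indep S"
  using rank_of_attained[of S] assms by (metis card_seteq)

lemma basis_indep: "basis A \<Longrightarrow> indep A"
  unfolding basis_def by blast

lemma basis_maximal: "basis A \<Longrightarrow> indep I \<Longrightarrow> A \<subseteq> I \<Longrightarrow> I = A"
  unfolding basis_def by blast

lemma card_basis: "basis A \<Longrightarrow> card A = rank_of E"
  using indep_extend[of A E] basis_maximal basis_indep indep_ground by metis

end

section \<open>Dependent sets and bases of spikes\<close>

context spike
begin

abbreviation legs :: "nat set" where "legs \<equiv> {1..r}"

text \<open>Index 0 stands for the tip, so that a leg is \<open>H 0 \<union> H i\<close> and is treated like the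
  union \<open>H i \<union> H j\<close> of two pairs.\<close>
definition H :: "nat \<Rightarrow> 'a set" where
  "H i = (if i = 0 then {t} else {x i, y i})"

lemma x_neq_y: "i \<in> legs \<Longrightarrow> j \<in> legs \<Longrightarrow> x i \<noteq> y j"
  using disjoint_xy by blast

lemma x_neq_t: "i \<in> legs \<Longrightarrow> x i \<noteq> t" and y_neq_t: "i \<in> legs \<Longrightarrow> y i \<noteq> t"
  using tip_notin by auto

lemma H_disjoint:
  assumes "i \<le> r" "j \<le> r" "u \<in> H i" "u \<in> H j"
  shows "i = j"
proof (cases "i = 0 \<or> j = 0")
  case True
  then show ?thesis using assms x_neq_t[of i] y_neq_t[of i] x_neq_t[of j] y_neq_t[of j]
    by (cases "i = 0"; cases "j = 0") (auto simp: H_def)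
next
  case False
  then have "i \<in> legs" "j \<in> legs" using assms by auto
  then show ?thesis
    using assms False x_neq_y[of i j] x_neq_y[of j i] inj_onD[OF inj_x] inj_onD[OF inj_y]
    by (auto simp: H_def)
qed

lemma ground_eq: "E = (\<Union>i\<le>r. H i)"
proof
  show "E \<subseteq> (\<Union>i\<le>r. H i)"
  proof
    fix u assume "u \<in> E"
    then consider "u = t" | i where "i \<in> legs" "u = x i \<or> u = y i" unfolding ground by blast
    then show "u \<in> (\<Union>i\<le>r. H i)"
    proof cases
      case 1
      then have "u \<in> H 0" by (simp add: H_def)
      then show ?thesis by blast
    next
      case 2
      then have "u \<in> H i" "i \<le> r" by (auto simp: H_def)
      then show ?thesis by blast
    qed
  qed
  show "(\<Union>i\<le>r. H i) \<subseteq> E" unfolding ground by (auto simp: H_def split: if_splits)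
qed

lemma H_eq: "i \<in> legs \<Longrightarrow> H i = {x i, y i}"
  by (simp add: H_def)

lemma card_H: "i \<in> legs \<Longrightarrow> card (H i) = 2"
  using x_neq_y by (simp add: H_eq)

lemma circuit_leg: "i \<in> legs \<Longrightarrow> circuit (insert t (H i))"
  using leg_circuit by (simp add: H_eq)

text \<open>A leg is a circuit, so its part \<open>{t, x i}\<close> is an independent set with two
  elements.\<close>

lemma two_le_r:
  assumes "i \<in> legs" shows "2 \<le> r"
proof -
  have "{t, x i} \<subset> {t, x i, y i}" using x_neq_y[of i i] y_neq_t[of i] assms by auto
  then have "indep {t, x i}" using leg_circuit[OF assms] unfolding circuit_def by blast
  then have "card {t, x i} \<le> r" using card_le_rank_of[of _ E] indep_ground rank by metis
  then show ?thesis using x_neq_t[OF assms] by auto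
qed

section \<open>Independent sets built from partial choices\<close>

definition choice_on :: "nat set \<Rightarrow> (nat \<Rightarrow> 'a) \<Rightarrow> bool" where
  "choice_on K f \<longleftrightarrow> (\<forall>i\<in>K. f i \<in> H i)"

lemma choice_on_subset: "choice_on K f \<Longrightarrow> L \<subseteq> K \<Longrightarrow> choice_on L f"
  unfolding choice_on_def by blast

lemma inj_on_choice: "choice_on K f \<Longrightarrow> K \<subseteq> legs \<Longrightarrow> inj_on f K"
  unfolding choice_on_def inj_on_def by (metis H_disjoint atLeastAtMost_iff subsetD)

lemma card_legs_Diff1: "k \<in> legs \<Longrightarrow> card (legs - {k}) = r - 1"
  by simp

lemma card_legs_Diff2:
  assumes "k \<in> legs" "l \<in> legs" "l \<noteq> k"
  shows "card (legs - {k, l}) = r - 2"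
proof -
  have "card (legs - {k, l}) = card legs - card {k, l}"
    using assms by (intro card_Diff_subset) auto
  then show ?thesis using assms(3) by simp
qed

text \<open>The unchosen element of each leg is spanned by the tip and the chosen one, since the leg
  is a circuit.\<close>

lemma rank_of_tip_choice:
  assumes "K \<subseteq> legs" "choice_on K f" "K \<noteq> {}"
  shows "rank_of (insert t (f ` K)) = rank_of (\<Union>i\<in>K. {t, x i, y i})"
proof (rule rank_of_eq_if_spanned)
  have "\<forall>i\<in>K. f i = x i \<or> f i = y i"
    using assms unfolding choice_on_def by (metis H_eq empty_iff insertE subsetD)
  then show "insert t (f ` K) \<subseteq> (\<Union>i\<in>K. {t, x i, y i})" using assms(3) by auto
  fix e assume e: "e \<in> (\<Union>i\<in>K. {t, x i, y i}) - insert t (f ` K)"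
  then obtain i where i: "i \<in> K" "e \<in> {x i, y i}" by blast
  then have "e \<in> H i" using assms(1) H_eq by blast
  moreover have "f i \<in> H i" using i(1) assms(2) unfolding choice_on_def by blast
  moreover have "e \<noteq> f i" using e i by auto
  moreover have "H i = {x i, y i}" using i assms(1) H_eq by blast
  ultimately have "H i = {e, f i}" by auto
  then show "\<exists>C. circuit C \<and> e \<in> C \<and> C \<subseteq> insert e (insert t (f ` K))"
    using circuit_leg[of i] i assms(1) by (intro exI[of _ "insert t (H i)"]) auto
qed

text \<open>The tip and the chosen elements have the rank \<open>card K + 1\<close> of the legs in
  \<open>K\<close> and at most that many elements. Properness of \<open>K\<close> keeps its size in
  the range of \<open>legs_rank\<close>; for empty \<open>K\<close> the set \<open>{t}\<close> is a
  proper part of a leg.\<close>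

lemma indep_tip_choice:
  assumes "K \<subset> legs" "choice_on K f"
  shows "indep (insert t (f ` K))"
proof (cases "K = {}")
  case True
  then obtain i where i: "i \<in> legs" using assms(1) by blast
  have "{t} \<subset> {t, x i, y i}" using x_neq_t[OF i] by auto
  then show ?thesis using leg_circuit[OF i] True unfolding circuit_def by auto
next
  case False
  have fin: "finite K" using assms(1) finite_subset by blast
  have "card K < card legs" using assms(1) by (intro psubset_card_mono) auto
  then have "card K \<le> r - 1" "1 \<le> card K"
    using False fin by (auto simp: Suc_le_eq card_gt_0_iff)
  then have "rank_of (\<Union>i\<in>K. {t, x i, y i}) = card K + 1"
    using assms(1) by (intro legs_rank) auto
  then have "rank_of (insert t (f ` K)) = card K + 1"
    using rank_of_tip_choice[OF psubset_imp_subset[OF assms(1)] assms(2) False] by simp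
  moreover have "card (insert t (f ` K)) \<le> card K + 1"
    using card_image_le[OF fin, of f] fin by (simp add: card_insert_if)
  ultimately show ?thesis using fin by (intro indep_if_card_le_rank_of) auto
qed

text \<open>For \<open>l \<noteq> 0\<close> the tip is spanned by \<open>H l\<close>, so adding it
  does not change the rank. With the tip added, the set contains an independent set of size
  \<open>r\<close> given by \<open>indep_tip_choice\<close>. The original set has at most
  \<open>r\<close> elements, hence is independent.\<close>

lemma indep_skew:
  assumes k: "k \<in> legs" and l: "l \<le> r" "l \<noteq> k" and f: "choice_on (legs - {k, l}) f"
  shows "indep (H l \<union> f ` (legs - {k, l}))"
proof (cases "l = 0")
  case True
  then have "l \<notin> legs" by simp
  then have eq: "legs - {k, l} = legs - {k}" by blast
  have "indep (insert t (f ` (legs - {k})))"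
    by (rule indep_tip_choice) (use k f[unfolded eq] in blast)+
  then show ?thesis using True unfolding eq by (simp add: H_def)
next
  case False
  let ?S = "H l \<union> f ` (legs - {k, l})"
  have lI: "l \<in> legs" using l False by auto
  define g where "g = f(l := x l)"
  have g: "choice_on (legs - {k}) g"
    using f lI unfolding choice_on_def g_def by (simp add: H_def)
  have ind: "indep (insert t (g ` (legs - {k})))"
    by (rule indep_tip_choice[OF _ g]) (use k in blast)
  have sub: "insert t (g ` (legs - {k})) \<subseteq> insert t ?S"
    unfolding g_def by (auto simp: H_eq[OF lI])
  have "card (g ` (legs - {k})) = r - 1"
    using card_image[OF inj_on_choice[OF g Diff_subset]] card_legs_Diff1[OF k] by simp
  moreover have "t \<notin> g ` (legs - {k})"
  proof
    assume "t \<in> g ` (legs - {k})"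
    then obtain i where i: "i \<in> legs - {k}" "t = g i" by blast
    then have "t \<in> H i" using g unfolding choice_on_def by metis
    then show False using H_disjoint[of 0 i t] i(1) by (simp add: H_def)
  qed
  ultimately have "card (insert t (g ` (legs - {k}))) = r"
    using k by simp
  then have "r \<le> rank_of (insert t ?S)" using card_le_rank_of[OF ind sub] by simp
  moreover have "rank_of ?S = rank_of (insert t ?S)"
  proof (rule rank_of_eq_if_spanned)
    fix e assume "e \<in> insert t ?S - ?S"
    then show "\<exists>C. circuit C \<and> e \<in> C \<and> C \<subseteq> insert e ?S"
      using circuit_leg[OF lI] by (intro exI[of _ "insert t (H l)"]) blast
  qed blast
  moreover have "card ?S \<le> r"
  proof -
    have "card (f ` (legs - {k, l})) \<le> card (legs - {k, l})" by (intro card_image_le) auto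
    also have "\<dots> = r - 2" using card_legs_Diff2[OF k lI l(2)] .
    finally show ?thesis
      using card_Un_le[of "H l" "f ` (legs - {k, l})"] card_H[OF lI] two_le_r[OF k] by linarith
  qed
  moreover have "finite ?S" by (simp add: H_def)
  ultimately show ?thesis by (intro indep_if_card_le_rank_of) simp_all
qed

text \<open>Two legs have rank 3, too small for the four elements of their pairs. If one index is 0,
  the union is itself a leg.\<close>

lemma dependent_two_H:
  assumes "l \<le> r" "m \<le> r" "l \<noteq> m"
  shows "\<not> indep (H l \<union> H m)"
proof -
  have tip: "\<not> indep (H 0 \<union> H i)" if "i \<in> legs" for i
    using circuit_leg[OF that] unfolding circuit_def by (simp add: H_def)
  show ?thesis
  proof (cases "l = 0 \<or> m = 0")
    case True
    then show ?thesis using tip[of l] tip[of m] assms by (auto simp: Un_commute)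
  next
    case False
    then have lm: "l \<in> legs" "m \<in> legs" using assms by auto
    have "H l \<inter> H m = {}" using H_disjoint assms by blast
    then have card: "card (H l \<union> H m) = 4"
      using card_H lm by (subst card_Un_disjoint) (auto simp: H_def)
    show ?thesis
    proof
      assume ind: "indep (H l \<union> H m)"
      \<comment> \<open>The assumed independence itself puts \<open>k = 2\<close> into the range of
        \<open>legs_rank\<close>.\<close>
      then have "4 \<le> r" using card_le_rank_of[of _ E] indep_ground rank card by metis
      then have "rank_of (\<Union>i\<in>{l, m}. {t, x i, y i}) = 3"
        using legs_rank[of 2 "{l, m}"] lm assms(3) by auto
      moreover have sub: "H l \<union> H m \<subseteq> (\<Union>i\<in>{l, m}. {t, x i, y i})"
        using lm by (auto simp: H_eq)
      ultimately show False using card_le_rank_of[OF ind sub] card by linarith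
    qed
  qed
qed

text \<open>At most one \<open>H l\<close> lies inside \<open>C\<close>. Every other pair
  contributes at most one element, and these are collected by a choice.\<close>

lemma subset_skew:
  assumes "C \<subseteq> E" and k: "k \<in> legs" "C \<inter> H k = {}"
    and no_two: "\<And>l m. l \<le> r \<Longrightarrow> m \<le> r \<Longrightarrow> l \<noteq> m \<Longrightarrow> \<not> H l \<union> H m \<subseteq> C"
  obtains l f where "l \<le> r" "l \<noteq> k" "choice_on (legs - {k, l}) f"
    "C \<subseteq> H l \<union> f ` (legs - {k, l})"
proof -
  \<comment> \<open>The default 0 applies when \<open>C\<close> contains no \<open>H l\<close>; the
    tip is then outside \<open>C\<close> and merely enlarges the bound.\<close>
  define l where "l = (if \<exists>l\<le>r. H l \<subseteq> C then SOME l. l \<le> r \<and> H l \<subseteq> C else 0)"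
  have l: "l \<le> r \<and> (H l \<subseteq> C \<or> l = 0 \<and> (\<forall>m\<le>r. \<not> H m \<subseteq> C))"
    unfolding l_def using someI_ex[of "\<lambda>l. l \<le> r \<and> H l \<subseteq> C"] by auto
  have "l \<noteq> k" using l k by (auto simp: H_def split: if_splits)
  \<comment> \<open>The fallback \<open>y i\<close> also serves pairs that \<open>C\<close> misses,
    so \<open>f\<close> is a choice on all legs.\<close>
  define f where "f i = (if x i \<in> C then x i else y i)" for i
  have f: "choice_on (legs - {k, l}) f"
    unfolding choice_on_def f_def by (auto simp: H_eq)
  have "C \<subseteq> H l \<union> f ` (legs - {k, l})"
  proof
    fix u assume u: "u \<in> C"
    then obtain i where i: "i \<le> r" "u \<in> H i" using assms(1) ground_eq by auto
    show "u \<in> H l \<union> f ` (legs - {k, l})"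
    proof (cases "i = l")
      case False
      have "\<not> H i \<subseteq> C" using l no_two[of i l] i False by blast
      moreover have "i \<noteq> k" using i k u by blast
      moreover have "i \<noteq> 0" using i u \<open>\<not> H i \<subseteq> C\<close> by (auto simp: H_def)
      ultimately have "i \<in> legs - {k, l}" "u = f i"
        using i u False unfolding f_def by (auto simp: H_def)
      then show ?thesis by blast
    qed (use i in simp)
  qed
  then show thesis using that l \<open>l \<noteq> k\<close> f by blast
qed

text \<open>A set that misses a pair and contains no two of the \<open>H l\<close> lies in one of
  the independent sets of \<open>indep_skew\<close>.\<close>

lemma dependent_cases:
  assumes "C \<subseteq> E" "\<not> indep C"
  shows "(\<exists>l m. l \<le> r \<and> m \<le> r \<and> l \<noteq> m \<and> H l \<union> H m \<subseteq> C) \<or> (\<forall>i\<in>legs. C \<inter> H i \<noteq> {})"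
proof (rule ccontr)
  assume neg: "\<not> ?thesis"
  then obtain k where k: "k \<in> legs" "C \<inter> H k = {}" by blast
  obtain l f where "l \<le> r" "l \<noteq> k" "choice_on (legs - {k, l}) f"
    "C \<subseteq> H l \<union> f ` (legs - {k, l})"
  proof (rule subset_skew[OF assms(1) k])
    show "\<not> H l \<union> H m \<subseteq> C" if "l \<le> r" "m \<le> r" "l \<noteq> m" for l m
      using neg that by blast
  qed
  then show False using indep_skew[OF k(1)] indep_subset assms(2) by blast
qed

section \<open>The two kinds of bases\<close>

definition transversal :: "'a set \<Rightarrow> bool" where
  "transversal A \<longleftrightarrow> t \<notin> A \<and> (\<forall>i\<in>legs. \<exists>a. A \<inter> H i = {a})"

text \<open>Here \<open>k\<close> marks the missed pair and \<open>l\<close> the one taken in full.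
  Since \<open>H 0 = {t}\<close>, the value \<open>l = 0\<close> captures the bases through the tip,
  so they share one treatment with the others.\<close>

definition skew :: "'a set \<Rightarrow> nat \<Rightarrow> nat \<Rightarrow> bool" where
  "skew A k l \<longleftrightarrow> k \<in> legs \<and> l \<le> r \<and> l \<noteq> k \<and> H l \<subseteq> A \<and> A \<inter> H k = {} \<and> (l \<noteq> 0 \<longrightarrow> t \<notin> A) \<and>
    (\<forall>i\<in>legs - {k, l}. \<exists>a. A \<inter> H i = {a})"

lemma choice_image_Int_H:
  assumes "choice_on K f" "K \<subseteq> legs" "i \<le> r"
  shows "f ` K \<inter> H i = (if i \<in> K then {f i} else {})"
proof -
  have "j = i" if "j \<in> K" "f j \<in> H i" for j
    using H_disjoint[of j i "f j"] assms that unfolding choice_on_def by auto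
  moreover have "f i \<in> H i" if "i \<in> K" using assms that unfolding choice_on_def by auto
  ultimately show ?thesis by auto
qed

text \<open>A basis has \<open>r\<close> elements, so one that meets all \<open>r\<close> pairs is
  exhausted by one element from each. One that misses a pair lies in an independent set of the skew
  form by \<open>subset_skew\<close>, and maximality gives equality.\<close>

lemma basis_cases:
  assumes "basis A"
  obtains "transversal A" | k l where "skew A k l"
proof (cases "\<forall>i\<in>legs. A \<inter> H i \<noteq> {}")
  case True
  then obtain f where f: "\<forall>i\<in>legs. f i \<in> A \<inter> H i"
    using bchoice[of legs "\<lambda>i u. u \<in> A \<inter> H i"] by blast
  then have ch: "choice_on legs f" unfolding choice_on_def by blast
  have "inj_on f legs" by (rule inj_on_choice[OF ch subset_refl])
  then have "card (f ` legs) = card A"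
    using card_image[of f legs] card_basis[OF assms] rank by simp
  then have A: "f ` legs = A"
    using f finite_indep[OF basis_indep[OF assms]] by (intro card_subset_eq) auto
  have int: "A \<inter> H i = (if i \<in> legs then {f i} else {})" if "i \<le> r" for i
    using choice_image_Int_H[OF ch subset_refl that] A by simp
  have "A \<inter> H 0 = {}" using int[of 0] by simp
  then have "t \<notin> A" by (simp add: H_def)
  moreover have "\<exists>a. A \<inter> H i = {a}" if "i \<in> legs" for i
    using int[of i] that by simp
  ultimately have "transversal A" unfolding transversal_def by blast
  then show thesis using that by blast
next
  case False
  then obtain k where k: "k \<in> legs" "A \<inter> H k = {}" by blast
  have A: "indep A" "A \<subseteq> E" using assms basis_indep indep_ground by auto
  obtain l f where l: "l \<le> r" "l \<noteq> k" and f: "choice_on (legs - {k, l}) f"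
    and sub: "A \<subseteq> H l \<union> f ` (legs - {k, l})"
  proof (rule subset_skew[OF A(2) k])
    show "\<not> H l \<union> H m \<subseteq> A" if "l \<le> r" "m \<le> r" "l \<noteq> m" for l m
      using dependent_two_H[OF that] indep_subset[OF A(1)] by blast
  qed
  have eq: "A = H l \<union> f ` (legs - {k, l})"
    using basis_maximal[OF assms indep_skew[OF k(1) l f] sub] by simp
  have "A \<inter> H i = {f i}" if "i \<in> legs - {k, l}" for i
  proof -
    have "H l \<inter> H i = {}" using H_disjoint that l by fastforce
    moreover have "f ` (legs - {k, l}) \<inter> H i = {f i}"
      using choice_image_Int_H[OF f Diff_subset, of i] that by simp
    ultimately show ?thesis unfolding eq by blast
  qed
  moreover have "t \<notin> A" if "l \<noteq> 0"
  proof -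
    have "t \<notin> H l" using H_disjoint[of 0 l t] l that by (auto simp: H_def)
    have "f ` (legs - {k, l}) \<inter> H 0 = {}"
      using choice_image_Int_H[OF f Diff_subset, of 0] by simp
    then have t2: "t \<notin> f ` (legs - {k, l})" by (auto simp: H_def)
    with \<open>t \<notin> H l\<close> show ?thesis unfolding eq by blast
  qed
  moreover have "H l \<subseteq> A" using eq by blast
  ultimately have "skew A k l" unfolding skew_def using k l by blast
  then show thesis using that by blast
qed

text \<open>The partial choice has \<open>r - 1\<close> elements and is augmented from an
  independent set of size \<open>r\<close>, formed by \<open>H k\<close> and the choice on all legs
  except \<open>j\<close> and \<open>k\<close>. Outside \<open>H k\<close> that set adds nothing
  new, so the new element comes from \<open>H k\<close>.\<close>

lemma indep_choice_exchange:
  assumes k: "k \<in> legs" and f: "choice_on (legs - {k}) f"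
  shows "\<exists>p\<in>H k. indep (insert p (f ` (legs - {k})))"
proof -
  have "2 \<le> r" using two_le_r k by blast
  \<comment> \<open>Any leg other than \<open>k\<close> would serve; one exists because
    \<open>2 \<le> r\<close>.\<close>
  define j where "j = (if k = 1 then 2 else 1::nat)"
  have j: "j \<in> legs" "j \<noteq> k" using k \<open>2 \<le> r\<close> by (auto simp: j_def)
  let ?Z = "f ` (legs - {k})" and ?J = "H k \<union> f ` (legs - {j, k})"
  have Z: "indep ?Z"
    by (rule indep_subset[OF indep_tip_choice[OF _ f]]) (use k in blast)+
  have cZ: "card ?Z = r - 1"
    using card_image[OF inj_on_choice[OF f Diff_subset]] card_legs_Diff1[OF k] by simp
  have f': "choice_on (legs - {j, k}) f"
    by (rule choice_on_subset[OF f]) blast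
  have J: "indep ?J"
    by (rule indep_skew[OF j(1) _ _ f']) (use j k in simp_all)
  have "H k \<inter> f ` (legs - {j, k}) = {}"
    using choice_image_Int_H[OF f' Diff_subset, of k] k by (simp add: Int_commute)
  then have "card ?J = 2 + card (f ` (legs - {j, k}))"
    using card_H[OF k] by (subst card_Un_disjoint) (auto simp: H_def)
  also have "card (f ` (legs - {j, k})) = r - 2"
    using card_image[OF inj_on_choice[OF f' Diff_subset]] card_legs_Diff2[OF j(1) k] j(2) by simp
  finally have "card ?Z < card ?J" using cZ \<open>2 \<le> r\<close> by simp
  then obtain e where "e \<in> ?J - ?Z" "indep (insert e ?Z)"
    using indep_augment[OF Z J] by blast
  then show ?thesis by blast
qed

section \<open>Covering paths in spikes\<close>

definition P_plus_pair :: "'a set \<Rightarrow> 'a set \<Rightarrow> bool" where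
  "P_plus_pair A B \<longleftrightarrow> (\<exists>p. path_on p ((A - B) \<union> (B - A)) \<and> alternates p (A - B) (B - A) \<and>
    covers p (circuits_in (A \<union> B)))"

text \<open>This lets each asymmetric combination of bases be treated in one order only.\<close>

lemma P_plus_pair_commute: "P_plus_pair A B \<longleftrightarrow> P_plus_pair B A"
  unfolding P_plus_pair_def by (metis alternates_commute Un_commute)

text \<open>The path is \<open>Q\<close>, then a zigzag through the legs outside \<open>K\<close> on
  which \<open>A\<close> and \<open>B\<close> differ, then \<open>R\<close>. If a circuit avoids the
  path and contains two of the \<open>H l\<close>, both indices belong to \<open>K\<close>, and
  \<open>two\<close> applies. If it meets every leg, \<open>full\<close> applies, and may use what
  the domino argument yields from the end of \<open>Q\<close> or from \<open>R\<close>.\<close>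

lemma P_plus_pair_criterion:
  assumes AB: "A \<subseteq> E" "B \<subseteq> E" and K: "K \<subseteq> {..r}"
    and tip: "0 \<notin> K \<Longrightarrow> t \<notin> A \<union> B"
    and single: "\<And>i. i \<in> legs - K \<Longrightarrow> (\<exists>a. A \<inter> H i = {a}) \<and> (\<exists>b. B \<inter> H i = {b})"
    and dist: "distinct (Q @ R)"
    and set: "set (Q @ R) = (\<Union>i\<in>K. H i) \<inter> ((A - B) \<union> (B - A))"
    and alt: "alternates Q (A - B) (B - A)"
    and last: "Q = [] \<or> last Q \<in> B - A"
    and R: "R = [] \<or> (\<exists>v\<in>A - B. R = [v])"
    and two: "\<And>l m. l \<in> K \<Longrightarrow> m \<in> K \<Longrightarrow> l \<noteq> m \<Longrightarrow> H l \<union> H m \<subseteq> A \<union> B \<Longrightarrow> \<not> avoids (H l \<union> H m) Q"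
    and full: "\<And>C. circuit C \<Longrightarrow> C \<subseteq> A \<union> B \<Longrightarrow> (\<And>i. i \<in> legs \<Longrightarrow> C \<inter> H i \<noteq> {}) \<Longrightarrow> avoids C Q \<Longrightarrow>
      (Q \<noteq> [] \<Longrightarrow> last Q \<in> C \<Longrightarrow> (R = [] \<or> hd R \<notin> C) \<and> (\<forall>i\<in>legs - K. C \<inter> H i \<subseteq> B)) \<Longrightarrow>
      (R \<noteq> [] \<Longrightarrow> hd R \<in> C \<Longrightarrow> \<forall>i\<in>legs - K. C \<inter> H i \<subseteq> A) \<Longrightarrow> False"
  shows "P_plus_pair A B"
proof -
  define a b where "a i = (THE u. A \<inter> H i = {u})" and "b i = (THE u. B \<inter> H i = {u})" for i
  have a: "A \<inter> H i = {a i}" and b: "B \<inter> H i = {b i}" if "i \<in> legs - K" for i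
    using single[OF that] unfolding a_def b_def by auto
  define D where "D = {i \<in> legs - K. a i \<noteq> b i}"
  have "finite D" by (simp add: D_def)
  then obtain ds where ds: "set ds = D" "distinct ds" using finite_distinct_list by blast
  have D: "i \<in> legs" "i \<le> r" "i \<notin> K" "a i \<in> A - B" "b i \<in> B - A" "a i \<in> H i" "b i \<in> H i"
      "H i = {a i, b i}" "a i \<noteq> b i"
    if "i \<in> set ds" for i
  proof -
    have i: "i \<in> legs - K" "a i \<noteq> b i" using that unfolding ds D_def by auto
    have ai: "a i \<in> A" "a i \<in> H i" and bi: "b i \<in> B" "b i \<in> H i"
      using a[OF i(1)] b[OF i(1)] by blast+
    show "i \<in> legs" "i \<notin> K" "a i \<in> H i" "b i \<in> H i" "a i \<noteq> b i" "i \<le> r" using i ai bi by auto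
    have "a i \<notin> B" using b[OF i(1)] ai i(2) by blast
    then show "a i \<in> A - B" using ai by blast
    have "b i \<notin> A" using a[OF i(1)] bi(2) i(2) by (metis IntI singletonD)
    then show "b i \<in> B - A" using bi by blast
    have "H i = {x i, y i}" using i H_eq by blast
    then show "H i = {a i, b i}" using ai bi i(2) by auto
  qed
  let ?W = "zigzag a b ds"
  let ?p = "Q @ ?W @ R"
  have W_disj: "u \<notin> (\<Union>i\<in>K. H i)" if W: "u \<in> set ?W" for u
  proof
    assume "u \<in> (\<Union>i\<in>K. H i)"
    then obtain j where j: "j \<in> K" "u \<in> H j" by blast
    obtain i where i: "i \<in> set ds" "u = a i \<or> u = b i" using W unfolding set_zigzag by blast
    then have "u \<in> H i" using D by blast
    then have "i = j" using H_disjoint j K D(2)[OF i(1)] by blast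
    then show False using D(3)[OF i(1)] j by blast
  qed
  have "distinct ?W"
  proof (rule distinct_zigzag[OF ds(2)])
    show "a i \<noteq> b i" if "i \<in> set ds" for i using D(9)[OF that] .
    show "{a i, b i} \<inter> {a j, b j} = {}" if "i \<in> set ds" "j \<in> set ds" "i \<noteq> j" for i j
      using H_disjoint[of i j] that D(2,8) by blast
  qed
  moreover have "set ?W \<inter> set (Q @ R) = {}" using W_disj unfolding set by blast
  ultimately have "distinct ?p" using dist by auto
  moreover have "set ?p = (A - B) \<union> (B - A)"
  proof
    have "set ?W \<subseteq> (A - B) \<union> (B - A)" unfolding set_zigzag using D(4,5) by blast
    then show "set ?p \<subseteq> (A - B) \<union> (B - A)" using set by auto
    show "(A - B) \<union> (B - A) \<subseteq> set ?p"
    proof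
      fix u assume u: "u \<in> (A - B) \<union> (B - A)"
      show "u \<in> set ?p"
      proof (cases "u \<in> (\<Union>i\<in>K. H i)")
        case True
        then have "u \<in> set (Q @ R)" unfolding set using u by blast
        then show ?thesis by auto
      next
        case False
        obtain i where i: "i \<le> r" "u \<in> H i" using u AB ground_eq by blast
        then have iK: "i \<notin> K" using False by blast
        have "i \<noteq> 0"
        proof
          assume "i = 0"
          then show False using tip iK i(2) u by (auto simp: H_def)
        qed
        then have il: "i \<in> legs - K" using i iK by simp
        have "u = a i \<and> u \<noteq> b i \<or> u = b i \<and> u \<noteq> a i" using a[OF il] b[OF il] i u by blast
        then have "i \<in> set ds" using il unfolding ds D_def by auto
        then show ?thesis using \<open>u = a i \<and> u \<noteq> b i \<or> u = b i \<and> u \<noteq> a i\<close> by (auto simp: set_zigzag)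
      qed
    qed
  qed
  moreover have "alternates ?p (A - B) (B - A)"
  proof -
    have "alternates (?W @ R) (A - B) (B - A) \<and> (?W @ R = [] \<or> hd (?W @ R) \<in> A - B)"
      by (rule alternates_zigzag_append)
        (use D(4,5) R in \<open>auto simp: alternates_iff_successively\<close>)
    then show ?thesis using alt last unfolding alternates_iff_successively
      by (subst successively_append_iff) blast
  qed
  moreover have "covers ?p (circuits_in (A \<union> B))"
    unfolding covers_iff_not_avoids
  proof (intro ballI notI)
    fix C assume "C \<in> circuits_in (A \<union> B)" and av: "avoids C ?p"
    then have C: "circuit C" "C \<subseteq> A \<union> B" unfolding circuits_in_def by auto
    then have C': "C \<subseteq> E" "\<not> indep C" unfolding circuit_def by auto
    have avQ: "avoids C Q" and avW: "avoids C (?W @ R)"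
      using av unfolding successively_append_iff by blast+
    \<comment> \<open>On a zigzag leg the full pair would contain the edge
      \<open>{a i, b i}\<close>; on a leg where \<open>A\<close> and \<open>B\<close> agree,
      \<open>A \<union> B\<close> has only one element of the pair.\<close>
    have no_pair: "i \<in> K" if i: "i \<le> r" "H i \<subseteq> C" for i
    proof (rule ccontr)
      assume iK: "i \<notin> K"
      have "i \<noteq> 0"
      proof
        assume "i = 0"
        then show False using tip iK i(2) C(2) by (auto simp: H_def)
      qed
      then have il: "i \<in> legs - K" using i iK by simp
      show False
      proof (cases "i \<in> set ds")
        case True
        then show False using avoids_zigzag_pair[OF avW True] D(6,7)[OF True] i by blast
      next
        case False
        then have "a i = b i" using il unfolding ds D_def by blast
        then have "(A \<union> B) \<inter> H i = {a i}" using a[OF il] b[OF il] by (simp add: Int_Un_distrib2)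
        then have "H i \<subseteq> {a i}" using i(2) C(2) by blast
        then have "card (H i) \<le> 1" using card_mono[of "{a i}" "H i"] by simp
        then show False using card_H[of i] il by simp
      qed
    qed
    consider l m where "l \<le> r" "m \<le> r" "l \<noteq> m" "H l \<union> H m \<subseteq> C"
      | "\<And>i. i \<in> legs \<Longrightarrow> C \<inter> H i \<noteq> {}"
      using dependent_cases[OF C'] by blast
    then show False
    proof cases
      case 1
      then have "l \<in> K" "m \<in> K" using no_pair by blast+
      then show False using two[of l m] 1 C(2) avoids_subset[OF avQ, of "H l \<union> H m"] by blast
    next
      case 2
      have meet: "a i \<in> C \<or> b i \<in> C" if "i \<in> set ds" for i
        using 2[OF D(1)[OF that]] D(8)[OF that] by auto
      have same: "C \<inter> H i \<subseteq> A \<inter> B" if "i \<in> legs - K" "i \<notin> set ds" for i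
      proof -
        have "a i = b i" using that unfolding ds D_def by blast
        then have "A \<inter> H i = B \<inter> H i" using a[OF that(1)] b[OF that(1)] by simp
        then show ?thesis using C(2) by blast
      qed
      show False
      proof (rule full[OF C 2 avQ])
        assume Q: "Q \<noteq> []" "last Q \<in> C"
        \<comment> \<open>Started at the end of \<open>Q\<close>, the domino argument leaves only
          the \<open>b i\<close> in \<open>C\<close>, so \<open>C\<close> stays inside
          \<open>B\<close> on the legs outside \<open>K\<close>.\<close>
        have "avoids C (last Q # ?W @ R)"
          using av Q(1) unfolding successively_append_iff[of _ Q] successively_Cons by blast
        then have *: "(\<forall>i\<in>set ds. a i \<notin> C) \<and> (R = [] \<or> hd R \<notin> C)"
          using Q(2) meet by (intro avoids_zigzag_forward)
        have "C \<inter> H i \<subseteq> B" if "i \<in> legs - K" for i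
        proof (cases "i \<in> set ds")
          case True
          then show ?thesis using * D(5,8)[OF True] by auto
        qed (use same[OF that] in blast)
        then show "(R = [] \<or> hd R \<notin> C) \<and> (\<forall>i\<in>legs - K. C \<inter> H i \<subseteq> B)" using * by blast
      next
        assume R': "R \<noteq> []" "hd R \<in> C"
        then have "R = [hd R]" using R by auto
        then have "avoids C (Q @ ?W @ [hd R])" using av by metis
        then have *: "\<forall>i\<in>set ds. b i \<notin> C"
          using avoids_zigzag_backward[of C Q a b ds "hd R"] R'(2) meet by blast
        have "C \<inter> H i \<subseteq> A" if "i \<in> legs - K" for i
        proof (cases "i \<in> set ds")
          case True
          then show ?thesis using * D(4,8)[OF True] by auto
        qed (use same[OF that] in blast)
        then show "\<forall>i\<in>legs - K. C \<inter> H i \<subseteq> A" by blast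
      qed
    qed
  qed
  ultimately show ?thesis unfolding P_plus_pair_def path_on_def by blast
qed

section \<open>Contributions of missed and full pairs to the symmetric difference\<close>

lemma mem_if_Int_singleton:
  assumes "C \<inter> S \<noteq> {}" "C \<subseteq> X" "X \<inter> S = {b}"
  shows "b \<in> C"
proof -
  obtain u where u: "u \<in> C" "u \<in> S" using assms(1) by blast
  then have "u \<in> X \<inter> S" using assms(2) by blast
  then show ?thesis using u(1) assms(3) by simp
qed

lemma Int_subset_if_sym_diff_singleton:
  assumes "S \<inter> ((A - B) \<union> (B - A)) = {d}" "C \<subseteq> A \<union> B" "d \<notin> C"
  shows "C \<inter> S \<subseteq> B"
proof
  fix u assume u: "u \<in> C \<inter> S"
  show "u \<in> B"
  proof (rule ccontr)
    assume "u \<notin> B"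
    then have "u \<in> S \<inter> ((A - B) \<union> (B - A))" using u assms(2) by blast
    then show False using u assms(1,3) by simp
  qed
qed

lemma legsI: "i \<le> r \<Longrightarrow> i \<noteq> 0 \<Longrightarrow> i \<in> legs"
  by simp

lemma H_neq: "i \<le> r \<Longrightarrow> j \<le> r \<Longrightarrow> i \<noteq> j \<Longrightarrow> u \<in> H i \<Longrightarrow> v \<in> H j \<Longrightarrow> u \<noteq> v"
  using H_disjoint by blast

lemma not_H_subset_if_singleton:
  assumes "i \<in> legs" "X \<inter> H i \<subseteq> {u}"
  shows "\<not> H i \<subseteq> X"
proof
  assume "H i \<subseteq> X"
  then have "H i \<subseteq> {u}" using assms(2) by blast
  then have "card (H i) \<le> 1" using card_mono[of "{u}" "H i"] by simp
  then show False using card_H[OF assms(1)] by simp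
qed

lemma subset_if_H_subset:
  assumes "C \<subseteq> E" "\<And>i. i \<le> r \<Longrightarrow> C \<inter> H i \<subseteq> X"
  shows "C \<subseteq> X"
  using assms ground_eq by blast

text \<open>The pair missed by \<open>A\<close> offers only \<open>b\<close> to circuits inside
  \<open>A \<union> B\<close>. Such a circuit contains \<open>b\<close> if it meets every
  leg.\<close>

lemma skew_missing:
  assumes "skew A k l" "B \<inter> H k = {b}"
  shows "b \<in> B - A" "b \<in> H k" "H k \<inter> ((A - B) \<union> (B - A)) = {b}" "\<not> H k \<subseteq> A \<union> B"
    "(A \<union> B) \<inter> H k = {b}"
proof -
  have Ak: "A \<inter> H k = {}" "k \<in> legs" using assms(1) unfolding skew_def by blast+
  have b: "b \<in> B \<inter> H k" by (simp add: assms(2))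
  then show "b \<in> B - A" "b \<in> H k" using Ak(1) by blast+
  have "H k \<inter> ((A - B) \<union> (B - A)) = B \<inter> H k" using Ak(1) by blast
  then show "H k \<inter> ((A - B) \<union> (B - A)) = {b}" using assms(2) by simp
  show eq: "(A \<union> B) \<inter> H k = {b}" using Ak(1) assms(2) by (simp add: Int_Un_distrib2)
  show "\<not> H k \<subseteq> A \<union> B" by (rule not_H_subset_if_singleton[OF Ak(2)]) (simp add: eq)
qed

text \<open>\<open>B\<close> takes one element of the pair that \<open>A\<close> has in full, or
  none if this is the tip. Either way exactly one element is left over, and it goes into the prefix
  of the path.\<close>

lemma skew_extra:
  assumes "skew A k l" "l \<noteq> 0 \<Longrightarrow> \<exists>c. B \<inter> H l = {c}" "l = 0 \<Longrightarrow> t \<notin> B"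
  obtains d where "d \<in> A - B" "d \<in> H l" "H l \<inter> ((A - B) \<union> (B - A)) = {d}"
proof -
  have A: "H l \<subseteq> A" "l \<le> r" using assms(1) unfolding skew_def by blast+
  show thesis
  proof (cases "l = 0")
    case True
    then have Hl: "H l = {t}" by (simp add: H_def)
    show thesis by (rule that[of t]) (use assms(3)[OF True] A(1) Hl in auto)
  next
    case False
    then have l: "l \<in> legs" using A by simp
    obtain c where c: "B \<inter> H l = {c}" using assms(2) False by blast
    have cB: "c \<in> B \<inter> H l" by (simp add: c)
    then have "c = x l \<or> c = y l" using H_eq[OF l] by simp
    then have "\<exists>d. H l = {c, d} \<and> c \<noteq> d"
      using H_eq[OF l] x_neq_y[OF l l] by (metis insert_commute)
    then obtain d where d: "H l = {c, d}" "c \<noteq> d" by blast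
    have "d \<notin> B \<inter> H l" using d(2) by (simp add: c)
    then have "d \<notin> B" using d(1) by simp
    then show thesis using cB d A(1) by (intro that[of d]) auto
  qed
qed

lemma skew_single: "skew A k l \<Longrightarrow> i \<in> legs \<Longrightarrow> i \<noteq> k \<Longrightarrow> i \<noteq> l \<Longrightarrow> \<exists>a. A \<inter> H i = {a}"
  unfolding skew_def by simp

lemma skew_extra_skew:
  assumes "skew A k l" "skew B k' l'" "l \<noteq> l'" "l \<noteq> k'"
  obtains d where "d \<in> A - B" "d \<in> H l" "H l \<inter> ((A - B) \<union> (B - A)) = {d}"
proof (rule skew_extra[OF assms(1), of B])
  have l: "l \<le> r" using assms(1) unfolding skew_def by blast
  show "\<exists>c. B \<inter> H l = {c}" if "l \<noteq> 0"
    by (rule skew_single[OF assms(2) legsI[OF l that] assms(4,3)])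
  show "t \<notin> B" if "l = 0" using assms(2,3) that unfolding skew_def by simp
qed

section \<open>Pairs with at least one transversal\<close>

lemma P_plus_pair_transversals:
  assumes indep: "indep A" "indep B" and trans: "transversal A" "transversal B"
  shows "P_plus_pair A B"
proof (cases "A = B")
  case True
  have "\<not> circuit C" if "C \<subseteq> A \<union> B" for C
    using that True indep_subset[OF indep(1), of C] unfolding circuit_def by blast
  then have "circuits_in (A \<union> B) = {}" unfolding circuits_in_def by blast
  then have "path_on [] ((A - B) \<union> (B - A)) \<and> alternates [] (A - B) (B - A) \<and>
      covers [] (circuits_in (A \<union> B))"
    using True by (simp add: path_on_def alternates_def covers_def)
  then show ?thesis unfolding P_plus_pair_def by blast
next
  case False
  have AB: "A \<subseteq> E" "B \<subseteq> E" using indep indep_ground by auto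
  have tip: "t \<notin> A \<union> B" using trans unfolding transversal_def by blast
  have single: "(\<exists>a. A \<inter> H i = {a}) \<and> (\<exists>b. B \<inter> H i = {b})" if "i \<in> legs" for i
    using trans that unfolding transversal_def by blast
  have H0: "H 0 = {t}" by (simp add: H_def)
  obtain i where i: "i \<le> r" "A \<inter> H i \<noteq> B \<inter> H i"
    using False subset_if_H_subset[OF AB(1), of B] subset_if_H_subset[OF AB(2), of A]
    by (metis Int_lower1 subset_antisym)
  then have "i \<noteq> 0" using tip H0 by (intro notI) auto
  then have il: "i \<in> legs" using i by simp
  obtain a b where ab: "A \<inter> H i = {a}" "B \<inter> H i = {b}" using single[OF il] by auto
  have "a \<noteq> b" using ab i(2) by auto
  moreover have "a \<in> A \<inter> H i" "b \<in> B \<inter> H i" by (simp_all add: ab)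
  moreover have "a \<notin> B \<inter> H i" "b \<notin> A \<inter> H i" using \<open>a \<noteq> b\<close> by (simp_all add: ab)
  ultimately have neq: "a \<noteq> b" "a \<in> A - B" "b \<in> B - A" by blast+
  have sym: "H i \<inter> ((A - B) \<union> (B - A)) = {b, a}"
  proof -
    have "H i \<inter> ((A - B) \<union> (B - A)) = ((B \<inter> H i) \<union> (A \<inter> H i)) - ((A \<inter> H i) \<inter> (B \<inter> H i))"
      by blast
    then show ?thesis unfolding ab using \<open>a \<noteq> b\<close> by auto
  qed
  \<comment> \<open>The pair of one differing leg is split between the two ends of the path. A
    circuit that meets this leg contains an end: \<open>b\<close> starts the domino forward and
    leads to \<open>C \<subseteq> B\<close>, while \<open>a\<close> starts it backward and leads to
    \<open>C \<subseteq> A\<close>.\<close>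
  show ?thesis
  proof (rule P_plus_pair_criterion[where K = "{i}" and Q = "[b]" and R = "[a]"])
    show "set ([b] @ [a]) = (\<Union>i\<in>{i}. H i) \<inter> ((A - B) \<union> (B - A))"
      using sym by simp
  next
    fix C assume C: "circuit C" "C \<subseteq> A \<union> B" and meet: "\<And>i. i \<in> legs \<Longrightarrow> C \<inter> H i \<noteq> {}"
      and fw: "[b] \<noteq> [] \<Longrightarrow> last [b] \<in> C \<Longrightarrow>
        ([a] = [] \<or> hd [a] \<notin> C) \<and> (\<forall>j\<in>legs - {i}. C \<inter> H j \<subseteq> B)"
      and bw: "[a] \<noteq> [] \<Longrightarrow> hd [a] \<in> C \<Longrightarrow> \<forall>j\<in>legs - {i}. C \<inter> H j \<subseteq> A"
    have CE: "C \<subseteq> E" and dep: "\<not> indep C" using C unfolding circuit_def by auto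
    have C0: "C \<inter> H 0 = {}" using C(2) tip H0 by auto
    have legs: "j = 0 \<or> j = i \<or> j \<in> legs - {i}" if "j \<le> r" for j
      using legsI[OF that] by blast
    have "C \<inter> H i \<subseteq> (A \<inter> H i) \<union> (B \<inter> H i)" using C(2) by blast
    then have Ci: "C \<inter> H i \<subseteq> {a, b}" unfolding ab by blast
    show False
    proof (cases "b \<in> C")
      case True
      then have *: "a \<notin> C" "\<forall>j\<in>legs - {i}. C \<inter> H j \<subseteq> B" using fw by auto
      have "C \<subseteq> B"
      proof (rule subset_if_H_subset[OF CE])
        fix j assume "j \<le> r"
        from legs[OF this] show "C \<inter> H j \<subseteq> B"
        proof (elim disjE)
          show ?thesis if "j = i" using that Ci *(1) neq(3) by auto
        qed (use C0 *(2) in auto)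
      qed
      then show False using dep indep_subset[OF indep(2)] by blast
    next
      case False
      then have "a \<in> C" using meet[OF il] Ci by auto
      then have *: "\<forall>j\<in>legs - {i}. C \<inter> H j \<subseteq> A" using bw by auto
      have "C \<subseteq> A"
      proof (rule subset_if_H_subset[OF CE])
        fix j assume "j \<le> r"
        from legs[OF this] show "C \<inter> H j \<subseteq> A"
        proof (elim disjE)
          show ?thesis if "j = i" using that Ci False neq(2) by auto
        qed (use C0 * in auto)
      qed
      then show False using dep indep_subset[OF indep(1)] by blast
    qed
  qed (use AB i tip single neq in \<open>simp_all add: alternates_def\<close>)
qed

text \<open>A circuit meeting every leg contains \<open>b\<close>, the only element available on the
  pair missed by \<open>A\<close>. If uncovered, it avoids the neighbour \<open>d\<close>, and the
  domino started at \<open>b\<close> puts it inside the independent set \<open>B\<close>.\<close>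

lemma P_plus_pair_skew_transversal:
  assumes indep: "indep A" "indep B" and skew: "skew A k l" and trans: "transversal B"
  shows "P_plus_pair A B"
proof -
  have AB: "A \<subseteq> E" "B \<subseteq> E" using indep indep_ground by auto
  have kl: "k \<in> legs" "l \<le> r" "k \<le> r" "l \<noteq> k" using skew unfolding skew_def by auto
  have tB: "t \<notin> B" using trans unfolding transversal_def by blast
  have singleB: "\<exists>b. B \<inter> H i = {b}" if "i \<in> legs" for i
    using trans that unfolding transversal_def by blast
  obtain b where b: "B \<inter> H k = {b}" using singleB kl by blast
  note b' = skew_missing[OF skew b]
  obtain d where d: "d \<in> A - B" "d \<in> H l" "H l \<inter> ((A - B) \<union> (B - A)) = {d}"
  proof (rule skew_extra[OF skew, of B])
    show "\<exists>c. B \<inter> H l = {c}" if "l \<noteq> 0" using singleB legsI[OF kl(2) that] by blast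
    show "t \<notin> B" using tB .
  qed
  have singleA: "\<exists>a. A \<inter> H i = {a}" if "i \<in> legs - {k, l}" for i
    using skew that unfolding skew_def by simp
  have "t \<notin> A" if "l \<noteq> 0" using skew that unfolding skew_def by simp
  then have tip: "t \<notin> A \<union> B" if "0 \<notin> {k, l}" using tB that by simp
  show ?thesis
  proof (rule P_plus_pair_criterion[where K = "{k, l}" and Q = "[d, b]" and R = "[]"])
    show "(\<exists>a. A \<inter> H i = {a}) \<and> (\<exists>b. B \<inter> H i = {b})" if "i \<in> legs - {k, l}" for i
      using singleA[OF that] singleB[of i] that by blast
    show "set ([d, b] @ []) = (\<Union>i\<in>{k, l}. H i) \<inter> ((A - B) \<union> (B - A))"
      using d(3) b'(3) by auto
    show "\<not> avoids (H i \<union> H j) [d, b]"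
      if "i \<in> {k, l}" "j \<in> {k, l}" "i \<noteq> j" "H i \<union> H j \<subseteq> A \<union> B" for i j
      using that b'(4) by blast
  next
    fix C assume C: "circuit C" "C \<subseteq> A \<union> B" and meet: "\<And>i. i \<in> legs \<Longrightarrow> C \<inter> H i \<noteq> {}"
      and av: "avoids C [d, b]"
      and fw: "[d, b] \<noteq> [] \<Longrightarrow> last [d, b] \<in> C \<Longrightarrow>
        ([] = [] \<or> hd [] \<notin> C) \<and> (\<forall>i\<in>legs - {k, l}. C \<inter> H i \<subseteq> B)"
    have "b \<in> C" by (rule mem_if_Int_singleton[OF meet[OF kl(1)] C(2) b'(5)])
    then have *: "d \<notin> C" "\<forall>i\<in>legs - {k, l}. C \<inter> H i \<subseteq> B" using av fw by auto
    have "C \<subseteq> B"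
    proof (rule subset_if_H_subset)
      show "C \<subseteq> E" using C unfolding circuit_def by auto
      fix i assume "i \<le> r"
      then consider "i = k" | "i = l" | "i \<in> legs - {k, l}" | "i = 0" "0 \<notin> {k, l}" by force
      then show "C \<inter> H i \<subseteq> B"
      proof cases
        case 1
        have "C \<inter> H k \<subseteq> (A \<union> B) \<inter> H k" using C(2) by blast
        then show ?thesis using b'(1) unfolding b'(5) 1 by blast
      next
        case 2
        then show ?thesis using Int_subset_if_sym_diff_singleton[OF d(3) C(2) *(1)] by simp
      next
        case 3
        then show ?thesis using * by blast
      next
        case 4
        then have "H i = {t}" by (simp add: H_def)
        then show ?thesis using tip[OF 4(2)] C(2) by auto
      qed
    qed
    then show False using C(1) indep_subset[OF indep(2)] unfolding circuit_def by blast
  qed (use AB kl tip d(1) b'(1) in \<open>auto simp: alternates_iff_successively\<close>)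
qed

section \<open>Pairs of two skew bases\<close>

lemma P_plus_pair_skew_same:
  assumes AB: "A \<subseteq> E" "B \<subseteq> E" and skew: "skew A k l" "skew B k' l"
  shows "P_plus_pair A B"
proof -
  have A: "k \<in> legs" "l \<le> r" "k \<le> r" "l \<noteq> k" "A \<inter> H k = {}" "H l \<subseteq> A"
      "\<And>i. i \<in> legs - {k, l} \<Longrightarrow> \<exists>a. A \<inter> H i = {a}"
    and B: "k' \<in> legs" "k' \<le> r" "l \<noteq> k'" "B \<inter> H k' = {}" "H l \<subseteq> B"
      "\<And>i. i \<in> legs - {k', l} \<Longrightarrow> \<exists>a. B \<inter> H i = {a}"
    and tip: "l \<noteq> 0 \<Longrightarrow> t \<notin> A \<union> B"
    using skew unfolding skew_def by auto
  have l: "H l \<inter> ((A - B) \<union> (B - A)) = {}" using A(6) B(5) by blast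
  show ?thesis
  proof (cases "k = k'")
    case True
    \<comment> \<open>No circuit inside \<open>A \<union> B\<close> meets every leg, and neither
      \<open>H k\<close> nor \<open>H l\<close> touches the symmetric difference, so the prefix is
      empty.\<close>
    have k: "H k \<inter> (A \<union> B) = {}" using A(5) B(4) True by blast
    have Hk: "H k \<noteq> {}" using A(1) by (simp add: H_eq)
    show ?thesis
    proof (rule P_plus_pair_criterion[where K = "{k, l}" and Q = "[]" and R = "[]"])
      show "(\<exists>a. A \<inter> H i = {a}) \<and> (\<exists>b. B \<inter> H i = {b})" if "i \<in> legs - {k, l}" for i
        using A(7)[of i] B(6)[of i] True that by simp
      show "set ([] @ []) = (\<Union>i\<in>{k, l}. H i) \<inter> ((A - B) \<union> (B - A))"
        using k l by auto
      show "\<not> avoids (H i \<union> H j) []"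
        if "i \<in> {k, l}" "j \<in> {k, l}" "i \<noteq> j" "H i \<union> H j \<subseteq> A \<union> B" for i j
        using that k Hk by blast
      show False if "C \<subseteq> A \<union> B" "\<And>i. i \<in> legs \<Longrightarrow> C \<inter> H i \<noteq> {}" for C
        using that(1) that(2)[OF A(1)] k by blast
    qed (use AB A(2,3) tip in \<open>auto simp: alternates_iff_successively\<close>)
  next
    case False
    \<comment> \<open>A circuit meeting every leg contains \<open>a\<close> and \<open>b\<close>,
      the only elements available on the two missed pairs, and thus the edge between them.\<close>
    obtain a where a: "A \<inter> H k' = {a}" using A(7)[of k'] B(1,3) False by blast
    obtain b where b: "B \<inter> H k = {b}" using B(6)[of k] A(1,4) False by blast
    note a' = skew_missing[OF skew(2) a, unfolded Un_commute[of B A] Un_commute[of "B - A"]]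
    note b' = skew_missing[OF skew(1) b]
    show ?thesis
    proof (rule P_plus_pair_criterion[where K = "{k, k', l}" and Q = "[a, b]" and R = "[]"])
      show "(\<exists>a. A \<inter> H i = {a}) \<and> (\<exists>b. B \<inter> H i = {b})" if "i \<in> legs - {k, k', l}" for i
        using A(7)[of i] B(6)[of i] that by simp
      show "set ([a, b] @ []) = (\<Union>i\<in>{k, k', l}. H i) \<inter> ((A - B) \<union> (B - A))"
        using a'(3) b'(3) l by auto
      show "\<not> avoids (H i \<union> H j) [a, b]"
        if "i \<in> {k, k', l}" "j \<in> {k, k', l}" "i \<noteq> j" "H i \<union> H j \<subseteq> A \<union> B" for i j
        using that a'(4) b'(4) by blast
      show False if "C \<subseteq> A \<union> B" "\<And>i. i \<in> legs \<Longrightarrow> C \<inter> H i \<noteq> {}" "avoids C [a, b]" for C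
      proof -
        have "a \<in> C" by (rule mem_if_Int_singleton[OF that(2)[OF B(1)] that(1) a'(5)])
        moreover have "b \<in> C" by (rule mem_if_Int_singleton[OF that(2)[OF A(1)] that(1) b'(5)])
        ultimately show False using that(3) by simp
      qed
    qed (use AB A(2,3) B(2) tip a'(1) b'(1) in \<open>auto simp: alternates_iff_successively\<close>)
  qed
qed

text \<open>Both bases miss \<open>H k\<close>, so no circuit meets every leg. The zigzag leaves
  only circuits containing \<open>H l \<union> H l'\<close>, and these contain the edge
  \<open>{d, d'}\<close>.\<close>

lemma P_plus_pair_skew_same_missing:
  assumes AB: "A \<subseteq> E" "B \<subseteq> E" and skew: "skew A k l" "skew B k l'" and "l \<noteq> l'"
  shows "P_plus_pair A B"
proof -
  have A: "k \<in> legs" "l \<le> r" "k \<le> r" "l \<noteq> k" "A \<inter> H k = {}"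
      "\<And>i. i \<in> legs - {k, l} \<Longrightarrow> \<exists>a. A \<inter> H i = {a}" "l \<noteq> 0 \<Longrightarrow> t \<notin> A"
    using skew(1) unfolding skew_def by simp_all
  have B: "l' \<le> r" "l' \<noteq> k" "B \<inter> H k = {}"
      "\<And>i. i \<in> legs - {k, l'} \<Longrightarrow> \<exists>a. B \<inter> H i = {a}" "l' \<noteq> 0 \<Longrightarrow> t \<notin> B"
    using skew(2) unfolding skew_def by simp_all
  obtain d where d: "d \<in> A - B" "d \<in> H l" "H l \<inter> ((A - B) \<union> (B - A)) = {d}"
    by (rule skew_extra_skew[OF skew \<open>l \<noteq> l'\<close> A(4)])
  obtain d' where d': "d' \<in> B - A" "d' \<in> H l'" "H l' \<inter> ((A - B) \<union> (B - A)) = {d'}"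
    by (rule skew_extra_skew[OF skew(2,1) \<open>l \<noteq> l'\<close>[symmetric] B(2)]) (simp only: Un_commute)
  have k: "H k \<inter> (A \<union> B) = {}" using A(5) B(3) by blast
  have Hk: "H k \<noteq> {}" using A(1) by (simp add: H_eq)
  show ?thesis
  proof (rule P_plus_pair_criterion[where K = "{k, l, l'}" and Q = "[d, d']" and R = "[]"])
    show "(\<exists>a. A \<inter> H i = {a}) \<and> (\<exists>b. B \<inter> H i = {b})" if "i \<in> legs - {k, l, l'}" for i
      using A(6)[of i] B(4)[of i] that by simp
    show "set ([d, d'] @ []) = (\<Union>i\<in>{k, l, l'}. H i) \<inter> ((A - B) \<union> (B - A))"
      using d(3) d'(3) k by auto
    show "\<not> avoids (H i \<union> H j) [d, d']"
      if "i \<in> {k, l, l'}" "j \<in> {k, l, l'}" "i \<noteq> j" "H i \<union> H j \<subseteq> A \<union> B" for i j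
    proof -
      have "i \<noteq> k" "j \<noteq> k" using that(4) k Hk by blast+
      then have "{i, j} = {l, l'}" using that(1-3) by blast
      then have "d \<in> H i \<union> H j" "d' \<in> H i \<union> H j" using d(2) d'(2) by (auto simp: doubleton_eq_iff)
      then show ?thesis by simp
    qed
    show False if "C \<subseteq> A \<union> B" "\<And>i. i \<in> legs \<Longrightarrow> C \<inter> H i \<noteq> {}" for C
      using that(1) that(2)[OF A(1)] k by blast
  qed (use AB A(2,3,7) B(1,5) d(1) d'(1) in \<open>auto simp: alternates_iff_successively\<close>)
qed

text \<open>Each basis has in full the pair that the other misses, so all four elements enter the
  prefix. A circuit that meets every leg and contains no edge avoids \<open>q\<close>, which is
  adjacent to both elements of \<open>H l\<close>; so it contains \<open>q'\<close>, avoids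
  \<open>p'\<close> and follows \<open>B\<close> on the other legs.\<close>

lemma P_plus_pair_skew_crossing:
  assumes AB: "A \<subseteq> E" "B \<subseteq> E" and skew: "skew A k l" "skew B l k"
  shows "P_plus_pair A B"
proof -
  have k: "k \<in> legs" and l: "l \<in> legs" using skew unfolding skew_def by blast+
  have kl: "k \<le> r" "l \<le> r" "k \<noteq> l" "k \<noteq> 0" "l \<noteq> 0" using k l skew unfolding skew_def by auto
  have A: "A \<inter> H k = {}" "H l \<subseteq> A" "t \<notin> A" using skew(1) kl unfolding skew_def by simp_all
  have B: "B \<inter> H l = {}" "H k \<subseteq> B" "t \<notin> B" using skew(2) kl unfolding skew_def by simp_all
  have singleA: "\<exists>a. A \<inter> H i = {a}" if "i \<in> legs - {k, l}" for i
    using skew(1) that unfolding skew_def by simp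
  have singleB: "\<exists>b. B \<inter> H i = {b}" if "i \<in> legs - {k, l}" for i
    using skew(2) that unfolding skew_def by simp
  obtain q q' where q: "H k = {q, q'}" "q \<noteq> q'" using H_eq[OF k] x_neq_y[OF k k] by blast
  \<comment> \<open>\<open>f\<close> follows \<open>B\<close> outside \<open>k\<close> and
    \<open>l\<close>, and on leg \<open>k\<close> takes the element that ends the prefix.\<close>
  define f where "f = (\<lambda>i. THE b. B \<inter> H i = {b})(k := q')"
  have f: "B \<inter> H i = {f i}" if "i \<in> legs - {k, l}" for i
    using singleB[OF that] that unfolding f_def by auto
  have fk: "f k = q'" unfolding f_def by simp
  have "choice_on (legs - {l}) f"
    unfolding choice_on_def
  proof
    fix i assume i: "i \<in> legs - {l}"
    show "f i \<in> H i"
    proof (cases "i = k")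
      case True
      then show ?thesis using fk q(1) by simp
    next
      case False
      then have "f i \<in> B \<inter> H i" using f[of i] i by simp
      then show ?thesis by blast
    qed
  qed
  \<comment> \<open>With this \<open>p\<close> the only candidate for an uncovered transversal is independent.\<close>
  then obtain p where p: "p \<in> H l" "indep (insert p (f ` (legs - {l})))"
    using indep_choice_exchange[OF l] by blast
  have "\<exists>p'. H l = {p, p'} \<and> p \<noteq> p'"
    using p(1) H_eq[OF l] x_neq_y[OF l l] by auto
  then obtain p' where p': "H l = {p, p'}" "p \<noteq> p'" by blast
  have pA: "p \<in> A - B" "p' \<in> A - B" and qB: "q \<in> B - A" "q' \<in> B - A"
    using A B p'(1) q(1) by blast+
  have sym: "H l \<inter> ((A - B) \<union> (B - A)) = {p, p'}" "H k \<inter> ((A - B) \<union> (B - A)) = {q, q'}"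
    using pA qB p'(1) q(1) by auto
  show ?thesis
  proof (rule P_plus_pair_criterion[where K = "{l, k}" and Q = "[p, q, p', q']" and R = "[]"])
    show "(\<exists>a. A \<inter> H i = {a}) \<and> (\<exists>b. B \<inter> H i = {b})" if "i \<in> legs - {l, k}" for i
      using singleA[of i] singleB[of i] that by simp
    show "set ([p, q, p', q'] @ []) = (\<Union>i\<in>{l, k}. H i) \<inter> ((A - B) \<union> (B - A))"
      using sym by auto
    show "\<not> avoids (H i \<union> H j) [p, q, p', q']"
      if "i \<in> {l, k}" "j \<in> {l, k}" "i \<noteq> j" "H i \<union> H j \<subseteq> A \<union> B" for i j
    proof -
      have "H i \<union> H j = H l \<union> H k" using that(1-3) by blast
      then have "p \<in> H i \<union> H j" "q \<in> H i \<union> H j" using p'(1) q(1) by simp_all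
      then show ?thesis by simp
    qed
  next
    fix C assume C: "circuit C" "C \<subseteq> A \<union> B" and meet: "\<And>i. i \<in> legs \<Longrightarrow> C \<inter> H i \<noteq> {}"
      and av: "avoids C [p, q, p', q']"
      and fw: "[p, q, p', q'] \<noteq> [] \<Longrightarrow> last [p, q, p', q'] \<in> C \<Longrightarrow>
        ([] = [] \<or> hd [] \<notin> C) \<and> (\<forall>i\<in>legs - {l, k}. C \<inter> H i \<subseteq> B)"
    have "p \<in> C \<or> p' \<in> C" using meet[OF l] p'(1) by auto
    then have "q \<notin> C" using av by auto
    then have "q' \<in> C" using meet[OF k] q(1) by auto
    then have "p' \<notin> C" and rest: "\<forall>i\<in>legs - {l, k}. C \<inter> H i \<subseteq> B" using av fw by auto
    have "C \<subseteq> insert p (f ` (legs - {l}))"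
    proof (rule subset_if_H_subset)
      show "C \<subseteq> E" using C unfolding circuit_def by auto
      fix i assume "i \<le> r"
      then consider "i = l" | "i = k" | "i \<in> legs - {l, k}" | "i = 0" using legsI by blast
      then show "C \<inter> H i \<subseteq> insert p (f ` (legs - {l}))"
      proof cases
        case 1
        then show ?thesis using p'(1) \<open>p' \<notin> C\<close> by auto
      next
        case 2
        have "f k \<in> f ` (legs - {l})" using k kl(3) by blast
        then show ?thesis using q(1) \<open>q \<notin> C\<close> 2 fk by auto
      next
        case 3
        then have "C \<inter> H i \<subseteq> B \<inter> H i" using rest by blast
        also have "\<dots> = {f i}" using f[of i] 3 by blast
        finally show ?thesis using 3 by blast
      next
        case 4
        then have "H i = {t}" by (simp add: H_def)
        then show ?thesis using A(3) B(3) C(2) by auto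
      qed
    qed
    then show False using C(1) indep_subset[OF p(2)] unfolding circuit_def by blast
  qed (use AB kl A(3) B(3) pA qB p'(2) q(2) in \<open>auto simp: alternates_iff_successively\<close>)
qed

text \<open>Placing \<open>b\<close> between the two elements of \<open>H l\<close> covers the
  circuits that meet every leg: they contain \<open>b\<close> and one of its neighbours. The edge
  \<open>{p', d'}\<close> covers those containing \<open>H l \<union> H l'\<close>.\<close>

lemma P_plus_pair_skew_half_crossing:
  assumes AB: "A \<subseteq> E" "B \<subseteq> E" and skew: "skew A k l" "skew B l l'" and neq: "l' \<noteq> k"
  shows "P_plus_pair A B"
proof -
  have k: "k \<in> legs" and l: "l \<in> legs" using skew unfolding skew_def by blast+
  have kl: "k \<le> r" "l \<le> r" "l \<noteq> k" "l \<noteq> 0" "l' \<le> r" "l' \<noteq> l"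
    using k l skew unfolding skew_def by auto
  have A: "H l \<subseteq> A" "t \<notin> A" using skew(1) kl unfolding skew_def by simp_all
  have B: "B \<inter> H l = {}" "l' \<noteq> 0 \<Longrightarrow> t \<notin> B" using skew(2) unfolding skew_def by simp_all
  obtain p p' where p: "H l = {p, p'}" "p \<noteq> p'" using H_eq[OF l] x_neq_y[OF l l] by blast
  obtain b where b: "B \<inter> H k = {b}" using skew_single[OF skew(2) k] kl neq by blast
  note b' = skew_missing[OF skew(1) b]
  obtain d' where d': "d' \<in> B - A" "d' \<in> H l'" "H l' \<inter> ((A - B) \<union> (B - A)) = {d'}"
    by (rule skew_extra_skew[OF skew(2,1) kl(6) neq]) (simp only: Un_commute)
  have pA: "p \<in> A - B" "p' \<in> A - B" using A B p(1) by blast+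
  have sym: "H l \<inter> ((A - B) \<union> (B - A)) = {p, p'}"
    using pA p(1) by auto
  have "b \<noteq> d'" by (rule H_neq[OF kl(1,5) neq[symmetric] b'(2) d'(2)])
  show ?thesis
  proof (rule P_plus_pair_criterion[where K = "{k, l, l'}" and Q = "[p, b, p', d']" and R = "[]"])
    show "(\<exists>a. A \<inter> H i = {a}) \<and> (\<exists>b. B \<inter> H i = {b})" if "i \<in> legs - {k, l, l'}" for i
      using skew_single[OF skew(1), of i] skew_single[OF skew(2), of i] that by simp
    show "set ([p, b, p', d'] @ []) = (\<Union>i\<in>{k, l, l'}. H i) \<inter> ((A - B) \<union> (B - A))"
      using sym d'(3) b'(3) by auto
    show "\<not> avoids (H i \<union> H j) [p, b, p', d']"
      if "i \<in> {k, l, l'}" "j \<in> {k, l, l'}" "i \<noteq> j" "H i \<union> H j \<subseteq> A \<union> B" for i j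
    proof -
      have "i \<noteq> k" "j \<noteq> k" using that(4) b'(4) by blast+
      then have "H i \<union> H j = H l \<union> H l'" using that(1-3) by blast
      then have "p' \<in> H i \<union> H j" "d' \<in> H i \<union> H j" using p(1) d'(2) by simp_all
      then show ?thesis by simp
    qed
    show False if "C \<subseteq> A \<union> B" "\<And>i. i \<in> legs \<Longrightarrow> C \<inter> H i \<noteq> {}" "avoids C [p, b, p', d']" for C
    proof -
      have "b \<in> C" by (rule mem_if_Int_singleton[OF that(2)[OF k] that(1) b'(5)])
      moreover have "p \<in> C \<or> p' \<in> C" using that(2)[OF l] p(1) by auto
      ultimately show False using that(3) by auto
    qed
  qed (use AB kl(1,2,5) A(2) B(2) pA b'(1) d'(1) p(2) \<open>b \<noteq> d'\<close>
      in \<open>auto simp: alternates_iff_successively\<close>)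
qed

text \<open>The edge \<open>{a, b}\<close> covers the circuits that meet every leg, and
  \<open>{d, d'}\<close> those containing \<open>H l \<union> H l'\<close>.\<close>

lemma P_plus_pair_skew_distinct:
  assumes AB: "A \<subseteq> E" "B \<subseteq> E" and skew: "skew A k l" "skew B k' l'"
    and neq: "k \<noteq> k'" "l \<noteq> l'" "l \<noteq> k'" "l' \<noteq> k"
  shows "P_plus_pair A B"
proof -
  have k: "k \<in> legs" "k' \<in> legs" using skew unfolding skew_def by blast+
  have kl: "k \<le> r" "l \<le> r" "k' \<le> r" "l' \<le> r" "l \<noteq> k" "l' \<noteq> k'"
    using k skew unfolding skew_def by auto
  have tip: "l \<noteq> 0 \<Longrightarrow> t \<notin> A" "l' \<noteq> 0 \<Longrightarrow> t \<notin> B" using skew unfolding skew_def by simp_all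
  obtain a where a: "A \<inter> H k' = {a}" using skew_single[OF skew(1) k(2)] neq by blast
  obtain b where b: "B \<inter> H k = {b}" using skew_single[OF skew(2) k(1)] neq by blast
  note a' = skew_missing[OF skew(2) a, unfolded Un_commute[of B A] Un_commute[of "B - A"]]
  note b' = skew_missing[OF skew(1) b]
  obtain d where d: "d \<in> A - B" "d \<in> H l" "H l \<inter> ((A - B) \<union> (B - A)) = {d}"
    by (rule skew_extra_skew[OF skew neq(2,3)])
  obtain d' where d': "d' \<in> B - A" "d' \<in> H l'" "H l' \<inter> ((A - B) \<union> (B - A)) = {d'}"
    by (rule skew_extra_skew[OF skew(2,1) neq(2)[symmetric] neq(4)]) (simp only: Un_commute)
  have "a \<noteq> d" by (rule H_neq[OF kl(3,2) neq(3)[symmetric] a'(2) d(2)])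
  have "b \<noteq> d'" by (rule H_neq[OF kl(1,4) neq(4)[symmetric] b'(2) d'(2)])
  show ?thesis
  proof (rule P_plus_pair_criterion[where K = "{k, k', l, l'}" and Q = "[a, b, d, d']" and R = "[]"])
    show "(\<exists>a. A \<inter> H i = {a}) \<and> (\<exists>b. B \<inter> H i = {b})" if "i \<in> legs - {k, k', l, l'}" for i
      using skew_single[OF skew(1), of i] skew_single[OF skew(2), of i] that by simp
    show "set ([a, b, d, d'] @ []) = (\<Union>i\<in>{k, k', l, l'}. H i) \<inter> ((A - B) \<union> (B - A))"
      using a'(3) b'(3) d(3) d'(3) by auto
    show "\<not> avoids (H i \<union> H j) [a, b, d, d']"
      if "i \<in> {k, k', l, l'}" "j \<in> {k, k', l, l'}" "i \<noteq> j" "H i \<union> H j \<subseteq> A \<union> B" for i j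
    proof -
      have "i \<noteq> k" "j \<noteq> k" "i \<noteq> k'" "j \<noteq> k'" using that(4) a'(4) b'(4) by blast+
      then have "H i \<union> H j = H l \<union> H l'" using that(1-3) by blast
      then have "d \<in> H i \<union> H j" "d' \<in> H i \<union> H j" using d(2) d'(2) by simp_all
      then show ?thesis by simp
    qed
    show False if "C \<subseteq> A \<union> B" "\<And>i. i \<in> legs \<Longrightarrow> C \<inter> H i \<noteq> {}" "avoids C [a, b, d, d']" for C
    proof -
      have "a \<in> C" by (rule mem_if_Int_singleton[OF that(2)[OF k(2)] that(1) a'(5)])
      moreover have "b \<in> C" by (rule mem_if_Int_singleton[OF that(2)[OF k(1)] that(1) b'(5)])
      ultimately show False using that(3) by simp
    qed
  qed (use AB kl(1-4) tip a'(1) b'(1) d(1) d'(1) \<open>a \<noteq> d\<close> \<open>b \<noteq> d'\<close>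
      in \<open>auto simp: alternates_iff_successively\<close>)
qed

lemma P_plus_pair_skew_skew:
  assumes AB: "A \<subseteq> E" "B \<subseteq> E" and skew: "skew A k l" "skew B k' l'"
  shows "P_plus_pair A B"
proof -
  \<comment> \<open>The cases compare the missed and the full pairs of the two bases; the fifth is
    the fourth with \<open>A\<close> and \<open>B\<close> exchanged.\<close>
  consider "l = l'" | "l \<noteq> l'" "k = k'" | "l = k'" "l' = k" | "l = k'" "l' \<noteq> k"
    | "l \<noteq> k'" "l' = k" | "k \<noteq> k'" "l \<noteq> l'" "l \<noteq> k'" "l' \<noteq> k"
    by blast
  then show ?thesis
  proof cases
    case 1
    then show ?thesis using P_plus_pair_skew_same[OF AB] skew by blast
  next
    case 2
    then show ?thesis using P_plus_pair_skew_same_missing[OF AB] skew by blast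
  next
    case 3
    then show ?thesis using P_plus_pair_skew_crossing[OF AB] skew by blast
  next
    case 4
    then show ?thesis using P_plus_pair_skew_half_crossing[OF AB] skew by blast
  next
    case 5
    then have "P_plus_pair B A" using P_plus_pair_skew_half_crossing[OF AB(2,1)] skew by blast
    then show ?thesis unfolding P_plus_pair_commute[of A B] .
  next
    case 6
    then show ?thesis by (rule P_plus_pair_skew_distinct[OF AB skew])
  qed
qed

lemma property_P_plus_spike: "property_P_plus"
proof -
  have "P_plus_pair A B" if A: "basis A" and B: "basis B" for A B
  proof -
    have indep: "indep A" "indep B" using A B basis_indep by blast+
    then have AB: "A \<subseteq> E" "B \<subseteq> E" using indep_ground by blast+
    show ?thesis
    proof (rule basis_cases[OF A]; rule basis_cases[OF B])
      show ?thesis if "transversal A" "transversal B"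
        using P_plus_pair_transversals[OF indep that] .
      show ?thesis if "skew A k l" "transversal B" for k l
        using P_plus_pair_skew_transversal[OF indep that] .
      show ?thesis if "transversal A" "skew B k l" for k l
        using P_plus_pair_skew_transversal[OF indep(2,1) that(2,1)]
        unfolding P_plus_pair_commute[of A B] .
      show ?thesis if "skew A k l" "skew B k' l'" for k l k' l'
        using P_plus_pair_skew_skew[OF AB that] .
    qed
  qed
  then show ?thesis unfolding property_P_plus_def P_plus_pair_def by blast
qed

end

theorem theorem17:
  fixes E :: "'a set" and indep :: "'a set \<Rightarrow> bool"
    and r :: nat and t :: 'a and x y :: "nat \<Rightarrow> 'a"
  assumes "spike E indep r t x y"
  shows "matroid.property_P_plus E indep"
  using assms by (rule spike.property_P_plus_spike)

end
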